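(* Let $(G,\tau)$ be a locally minimal topological group. Then $w(G)=nw(G)$. In particular, every countable locally minimal group is metrizable.
   Context: Groups are written additively but are not necessarily abelian; $0$ is the neutral element. Neighborhoods are not necessarily open. A Hausdorff topological group $(G,\tau)$ is locally minimal if there exists a neighborhood $V$ of $0$ such that whenever $\sigma\le\tau$ is a (coarser) Hausdorff group topology on $G$ such that $V$ is a $\sigma$-neighborhood of $0$, then $\sigma=\tau$. The weight $w(X)$ of a topological space $X$ is the minimal cardinality of a basis for its topology. The netweight $nw(X)$ is the minimal cardinality of a network in $X$, i.e. of a family $\mathcal N$ of subsets of $X$ such that for every $x\in X$ and every open set $U$ containing $x$ there exists $N\in\mathcal N$ with $x\in N\subseteq U$. *)

theory Defs
  imports "HOL-Analysis.Analysis"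
begin

unbundle cardinal_syntax

text \<open>Local minimality quantifies over all group topologies on one group, so topologies are
  explicit values of type \<^typ>\<open>'a topology\<close> rather than type-class instances. The
  group is the whole type, written additively; \<^class>\<open>group_add\<close> does not assume
  commutativity.\<close>

definition group_topology :: "'a::group_add topology \<Rightarrow> bool" where
  "group_topology \<tau> \<longleftrightarrow>
     topspace \<tau> = UNIV \<and>
     continuous_map (prod_topology \<tau> \<tau>) \<tau> (\<lambda>(x, y). x + y) \<and>
     continuous_map \<tau> \<tau> uminus"

definition coarser_topology :: "'a topology \<Rightarrow> 'a topology \<Rightarrow> bool" where
  "coarser_topology \<sigma> \<tau> \<longleftrightarrow> (\<forall>U. openin \<sigma> U \<longrightarrow> openin \<tau> U)"

definition nbhd_of :: "'a topology \<Rightarrow> 'a \<Rightarrow> 'a set \<Rightarrow> bool" where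
  "nbhd_of \<tau> x V \<longleftrightarrow> V \<subseteq> topspace \<tau> \<and> (\<exists>U. openin \<tau> U \<and> x \<in> U \<and> U \<subseteq> V)"

definition locally_minimal :: "'a::group_add topology \<Rightarrow> bool" where
  "locally_minimal \<tau> \<longleftrightarrow>
     group_topology \<tau> \<and> Hausdorff_space \<tau> \<and>
     (\<exists>V. nbhd_of \<tau> 0 V \<and>
       (\<forall>\<sigma>. group_topology \<sigma> \<and> Hausdorff_space \<sigma> \<and> coarser_topology \<sigma> \<tau> \<and> nbhd_of \<sigma> 0 V
         \<longrightarrow> \<sigma> = \<tau>))"

definition basis_of :: "'a topology \<Rightarrow> 'a set set \<Rightarrow> bool" where
  "basis_of X \<B> \<longleftrightarrow>
     (\<forall>B\<in>\<B>. openin X B) \<and>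
     (\<forall>x U. openin X U \<and> x \<in> U \<longrightarrow> (\<exists>B\<in>\<B>. x \<in> B \<and> B \<subseteq> U))"

definition network_of :: "'a topology \<Rightarrow> 'a set set \<Rightarrow> bool" where
  "network_of X \<N> \<longleftrightarrow>
     (\<forall>N\<in>\<N>. N \<subseteq> topspace X) \<and>
     (\<forall>x U. openin X U \<and> x \<in> U \<longrightarrow> (\<exists>N\<in>\<N>. x \<in> N \<and> N \<subseteq> U))"

text \<open>The least cardinality of a set satisfying \<open>P\<close>. Cardinals are the well-orders of HOL's
  cardinal library, unique only up to \<open>=o\<close>, hence the choice of a witness. No
  convention is imposed that rounds finite values up to \<open>\<aleph>\<^sub>0\<close>.\<close>

definition min_card :: "('b set \<Rightarrow> bool) \<Rightarrow> 'b rel" where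
  "min_card P = |SOME A. P A \<and> (\<forall>B. P B \<longrightarrow> |A| \<le>o |B| )|"

definition weight :: "'a topology \<Rightarrow> 'a set rel" where
  "weight X = min_card (basis_of X)"

definition netweight :: "'a topology \<Rightarrow> 'a set rel" where
  "netweight X = min_card (network_of X)"

lemma min_card_witness:
  assumes "P A0"
  obtains A where "P A" "min_card P = |A|" "\<And>B. P B \<Longrightarrow> |A| \<le>o |B|"
proof -
  have "\<exists>r\<in>card_of ` Collect P. \<forall>r'\<in>card_of ` Collect P. r \<le>o r'"
    using assms by (intro exists_minim_Card_order) (auto simp: card_of_Card_order)
  then have "\<exists>A. P A \<and> (\<forall>B. P B \<longrightarrow> |A| \<le>o |B| )" by auto
  from someI_ex[OF this] show thesis
    by (intro that[of "SOME A. P A \<and> (\<forall>B. P B \<longrightarrow> |A| \<le>o |B| )"])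
       (auto simp: min_card_def)
qed

lemma weight_witness:
  obtains \<B> where "basis_of X \<B>" "weight X = |\<B>|" "\<And>\<C>. basis_of X \<C> \<Longrightarrow> |\<B>| \<le>o |\<C>|"
proof -
  have "basis_of X (Collect (openin X))" by (auto simp: basis_of_def)
  from min_card_witness[of "basis_of X", OF this] that show thesis
    unfolding weight_def by blast
qed

lemma netweight_witness:
  obtains \<N> where "network_of X \<N>" "netweight X = |\<N>|"
    "\<And>\<M>. network_of X \<M> \<Longrightarrow> |\<N>| \<le>o |\<M>|"
proof -
  have "network_of X (Pow (topspace X))"
    using openin_subset by (fastforce simp: network_of_def)
  from min_card_witness[of "network_of X", OF this] that show thesis
    unfolding netweight_def by blast
qed

end

theory Submission
  imports Defs
begin

text \<open>Let \<open>\<N>\<close> be an infinite network of a Hausdorff group topology \<open>\<tau>\<close>. Following Arhangel'skii,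
  \<open>\<tau>\<close> has a coarser Hausdorff group topology with a neighbourhood base at \<open>0\<close> of cardinality at
  most \<open>|\<N>|\<close>: for every neighbourhood \<open>V\<close> of \<open>0\<close>, \<open>|\<N>|\<close> right translates of \<open>V\<close> cover the group,
  so \<open>|\<N>|\<close> neighbourhoods suffice to control all conjugations, and \<open>|\<N>|\<close> neighbourhoods separate
  \<open>0\<close> from all other points; closing such a family under halving, conjugation and intersection
  keeps its size. The family may be chosen to contain a given neighbourhood of \<open>0\<close>, so local
  minimality forces the coarser topology to be \<open>\<tau>\<close>, and translating the base by a dense set picked
  from \<open>\<N>\<close> yields a basis of cardinality at most \<open>|\<N>|\<close>.\<close>

section \<open>Neighbourhoods in a group topology, and regularity\<close>

lemma group_topology_add_nbhds:
  assumes "group_topology \<tau>" "openin \<tau> U" "x + y \<in> U"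
  obtains A B where "openin \<tau> A" "x \<in> A" "openin \<tau> B" "y \<in> B"
    "\<And>a b. a \<in> A \<Longrightarrow> b \<in> B \<Longrightarrow> a + b \<in> U"
proof -
  have top: "topspace \<tau> = UNIV" and "continuous_map (prod_topology \<tau> \<tau>) \<tau> (\<lambda>(x, y). x + y)"
    using assms(1) by (auto simp: group_topology_def)
  then have "openin (prod_topology \<tau> \<tau>) {p. fst p + snd p \<in> U}"
    using assms(2) by (auto simp: continuous_map_def case_prod_unfold)
  then have "\<exists>A B. openin \<tau> A \<and> openin \<tau> B \<and> x \<in> A \<and> y \<in> B \<and> A \<times> B \<subseteq> {p. fst p + snd p \<in> U}"
    using assms(3) unfolding openin_prod_topology_alt by auto
  then show thesis using that by (force simp: subset_iff)
qed

lemma group_topology_uminus_open: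
  assumes "group_topology \<tau>" "openin \<tau> U"
  shows "openin \<tau> {x. - x \<in> U}"
  using assms by (auto simp: group_topology_def continuous_map_def)

lemma group_topology_translate_open:
  assumes "group_topology \<tau>" "openin \<tau> U"
  shows "openin \<tau> ((+) g ` U)"
proof (subst openin_subopen, intro ballI)
  fix x assume "x \<in> (+) g ` U"
  then have "- g + x \<in> U" by (auto simp: add.assoc[symmetric])
  then obtain A B where AB: "- g \<in> A" "openin \<tau> B" "x \<in> B"
    "\<And>a b. a \<in> A \<Longrightarrow> b \<in> B \<Longrightarrow> a + b \<in> U"
    using group_topology_add_nbhds[OF assms] by metis
  have "B \<subseteq> (+) g ` U"
  proof
    fix b assume "b \<in> B"
    then have "- g + b \<in> U" using AB by blast
    then show "b \<in> (+) g ` U" by (intro image_eqI[of _ _ "- g + b"]) (auto simp: add.assoc[symmetric])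
  qed
  then show "\<exists>T. openin \<tau> T \<and> x \<in> T \<and> T \<subseteq> (+) g ` U" using AB by blast
qed

lemma group_topology_translate_right_open:
  assumes "group_topology \<tau>" "openin \<tau> U"
  shows "openin \<tau> ((\<lambda>v. v + g) ` U)"
proof (subst openin_subopen, intro ballI)
  fix x assume "x \<in> (\<lambda>v. v + g) ` U"
  then have "x + (- g) \<in> U" by (auto simp: add.assoc)
  then obtain A B where AB: "openin \<tau> A" "x \<in> A" "- g \<in> B"
    "\<And>a b. a \<in> A \<Longrightarrow> b \<in> B \<Longrightarrow> a + b \<in> U"
    using group_topology_add_nbhds[OF assms] by metis
  have "A \<subseteq> (\<lambda>v. v + g) ` U"
  proof
    fix a assume "a \<in> A"
    then have "a + (- g) \<in> U" using AB by blast
    then show "a \<in> (\<lambda>v. v + g) ` U" by (intro image_eqI[of _ _ "a + (- g)"]) (auto simp: add.assoc)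
  qed
  then show "\<exists>T. openin \<tau> T \<and> x \<in> T \<and> T \<subseteq> (\<lambda>v. v + g) ` U" using AB by blast
qed

lemma group_topology_square_nbhd:
  assumes "group_topology \<tau>" "openin \<tau> U" "0 \<in> U"
  shows "\<exists>W. openin \<tau> W \<and> 0 \<in> W \<and> (\<forall>a\<in>W. \<forall>b\<in>W. a + b \<in> U \<and> a - b \<in> U)"
proof -
  obtain A B where AB: "openin \<tau> A" "0 \<in> A" "openin \<tau> B" "0 \<in> B"
    "\<And>a b. a \<in> A \<Longrightarrow> b \<in> B \<Longrightarrow> a + b \<in> U"
    using group_topology_add_nbhds[OF assms(1,2), of 0 0] assms(3) by auto
  \<comment> \<open>Intersecting with the negatives of \<open>B\<close> lets \<open>a - b\<close> be
    read as a sum of a point of \<open>A\<close> and a point of \<open>B\<close>.\<close>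
  define W where "W = A \<inter> B \<inter> {x. - x \<in> B}"
  have "openin \<tau> W" unfolding W_def
    using AB group_topology_uminus_open[OF assms(1)] by blast
  moreover have "\<forall>a\<in>W. \<forall>b\<in>W. a + b \<in> U \<and> a - b \<in> U"
    unfolding W_def using AB(5) by (fastforce simp: diff_conv_add_uminus simp del: add_uminus_conv_diff)
  ultimately show ?thesis using AB by (intro exI[of _ W]) (auto simp: W_def)
qed

lemma group_topology_conj_nbhd:
  assumes "group_topology \<tau>" "openin \<tau> U" "0 \<in> U"
  shows "\<exists>W. openin \<tau> W \<and> 0 \<in> W \<and> (\<forall>w\<in>W. g + w - g \<in> U)"
proof -
  \<comment> \<open>This is the translate \<open>- g + U + g\<close>, on which conjugation by
    \<open>g\<close> lands in \<open>U\<close>.\<close>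
  define W where "W = (+) (- g) ` (\<lambda>v. v + g) ` U"
  have "openin \<tau> W" unfolding W_def
    using assms group_topology_translate_open group_topology_translate_right_open by blast
  moreover have "0 \<in> W" unfolding W_def using assms(3) by (force intro: image_eqI[of _ _ g])
  moreover have "g + w - g \<in> U" if "w \<in> W" for w
    using that unfolding W_def by (auto simp: add.assoc[symmetric])
  ultimately show ?thesis by blast
qed

text \<open>If \<open>W - W\<close> lies in \<open>- x + U\<close>, then for \<open>y\<close> in the
  closure of \<open>x + W\<close> the translate \<open>y + W\<close> meets \<open>x + W\<close>, so
  \<open>y\<close> lies in \<open>x + W - W\<close> and hence in \<open>U\<close>. Regularity feeds
  the metrization of countable groups.\<close>

lemma group_topology_imp_regular_space:
  assumes "group_topology \<tau>"
  shows "regular_space \<tau>"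
  unfolding neighbourhood_base_of_closedin[symmetric] neighbourhood_base_of
proof (intro allI impI)
  fix U x assume "openin \<tau> U \<and> x \<in> U"
  then have "openin \<tau> ((+) (- x) ` U)" "0 \<in> (+) (- x) ` U"
    using group_topology_translate_open[OF assms] by (auto intro: image_eqI[of _ _ x])
  then obtain W where W: "openin \<tau> W" "0 \<in> W" "\<And>a b. a \<in> W \<Longrightarrow> b \<in> W \<Longrightarrow> a - b \<in> (+) (- x) ` U"
    using group_topology_square_nbhd[OF assms] by metis
  have op: "openin \<tau> ((+) y ` W)" "y \<in> (+) y ` W" for y
    using W group_topology_translate_open[OF assms] by (auto intro: image_eqI[of _ _ 0])
  have "\<tau> closure_of ((+) x ` W) \<subseteq> U"
  proof
    fix y assume "y \<in> \<tau> closure_of ((+) x ` W)"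
    then obtain z where "z \<in> (+) x ` W" "z \<in> (+) y ` W"
      using op[of y] unfolding in_closure_of by meson
    then obtain a b where ab: "a \<in> W" "b \<in> W" "y + b = x + a" by (metis imageE)
    then have "y = x + (a - b)" by (simp add: eq_diff_eq add_diff_eq)
    moreover obtain u where "u \<in> U" "a - b = - x + u" using W(3)[OF ab(1,2)] by blast
    ultimately show "y \<in> U" by (simp add: add.assoc[symmetric])
  qed
  then show "\<exists>A V. openin \<tau> A \<and> closedin \<tau> V \<and> x \<in> A \<and> A \<subseteq> V \<and> V \<subseteq> U"
    using op[of x] closure_of_subset[OF openin_subset[OF op(1)[of x]]]
    by (intro exI[of _ "(+) x ` W"] exI[of _ "\<tau> closure_of ((+) x ` W)"]) auto
qed

section \<open>Group topologies generated by a neighbourhood base at 0\<close>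

text \<open>The classical axioms for a base at the identity of a possibly non-abelian group. Halving
  and inversion share one clause: \<open>0 \<in> W\<close> turns \<open>a - b\<close> into a
  statement about negatives.\<close>

definition nbhd_base_at_zero :: "'a::group_add set set \<Rightarrow> bool" where
  "nbhd_base_at_zero \<Gamma> \<longleftrightarrow>
     \<Gamma> \<noteq> {} \<and> (\<forall>U\<in>\<Gamma>. 0 \<in> U) \<and>
     (\<forall>U\<in>\<Gamma>. \<forall>V\<in>\<Gamma>. \<exists>W\<in>\<Gamma>. W \<subseteq> U \<inter> V) \<and>
     (\<forall>U\<in>\<Gamma>. \<exists>W\<in>\<Gamma>. \<forall>a\<in>W. \<forall>b\<in>W. a + b \<in> U \<and> a - b \<in> U) \<and>
     (\<forall>U\<in>\<Gamma>. \<forall>g. \<exists>W\<in>\<Gamma>. \<forall>w\<in>W. g + w - g \<in> U)"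

text \<open>Under the axioms above this is the group topology in which \<open>\<Gamma>\<close> is a
  base of not necessarily open neighbourhoods of 0.\<close>

definition translate_topology :: "'a::group_add set set \<Rightarrow> 'a topology" where
  "translate_topology \<Gamma> = topology (\<lambda>U. \<forall>x\<in>U. \<exists>W\<in>\<Gamma>. \<forall>w\<in>W. x + w \<in> U)"

context
  fixes \<Gamma> :: "'a::group_add set set"
  assumes \<Gamma>: "nbhd_base_at_zero \<Gamma>"
begin

lemma nbhd_base_ne: "\<Gamma> \<noteq> {}"
  and nbhd_base_zero: "U \<in> \<Gamma> \<Longrightarrow> 0 \<in> U"
  and nbhd_base_Int: "U \<in> \<Gamma> \<Longrightarrow> V \<in> \<Gamma> \<Longrightarrow> \<exists>W\<in>\<Gamma>. W \<subseteq> U \<inter> V"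
  and nbhd_base_square: "U \<in> \<Gamma> \<Longrightarrow> \<exists>W\<in>\<Gamma>. \<forall>a\<in>W. \<forall>b\<in>W. a + b \<in> U \<and> a - b \<in> U"
  and nbhd_base_conj: "U \<in> \<Gamma> \<Longrightarrow> \<exists>W\<in>\<Gamma>. \<forall>w\<in>W. g + w - g \<in> U"
proof -
  note * = \<Gamma>[unfolded nbhd_base_at_zero_def]
  show "\<Gamma> \<noteq> {}" by (rule *[THEN conjunct1])
  show "U \<in> \<Gamma> \<Longrightarrow> 0 \<in> U" by (rule *[THEN conjunct2, THEN conjunct1, THEN bspec])
  show "U \<in> \<Gamma> \<Longrightarrow> V \<in> \<Gamma> \<Longrightarrow> \<exists>W\<in>\<Gamma>. W \<subseteq> U \<inter> V"
    by (rule *[THEN conjunct2, THEN conjunct2, THEN conjunct1, THEN bspec, THEN bspec])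
  show "U \<in> \<Gamma> \<Longrightarrow> \<exists>W\<in>\<Gamma>. \<forall>a\<in>W. \<forall>b\<in>W. a + b \<in> U \<and> a - b \<in> U"
    by (rule *[THEN conjunct2, THEN conjunct2, THEN conjunct2, THEN conjunct1, THEN bspec])
  show "U \<in> \<Gamma> \<Longrightarrow> \<exists>W\<in>\<Gamma>. \<forall>w\<in>W. g + w - g \<in> U"
    by (rule *[THEN conjunct2, THEN conjunct2, THEN conjunct2, THEN conjunct2, THEN bspec, THEN spec])
qed

text \<open>\<open>topology\<close> inverts \<open>openin\<close> only on predicates satisfying
  \<open>istopology\<close>; the intersection clause for \<open>\<Gamma>\<close> supplies closure
  under binary intersections.\<close>

lemma openin_translate_topology:
  "openin (translate_topology \<Gamma>) U \<longleftrightarrow> (\<forall>x\<in>U. \<exists>W\<in>\<Gamma>. \<forall>w\<in>W. x + w \<in> U)"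
proof -
  have "istopology (\<lambda>U. \<forall>x\<in>U. \<exists>W\<in>\<Gamma>. \<forall>w\<in>W. x + w \<in> U)"
    unfolding istopology_def
  proof (intro conjI allI impI ballI)
    fix S T x assume "\<forall>x\<in>S. \<exists>W\<in>\<Gamma>. \<forall>w\<in>W. x + w \<in> S" "\<forall>x\<in>T. \<exists>W\<in>\<Gamma>. \<forall>w\<in>W. x + w \<in> T" "x \<in> S \<inter> T"
    then obtain U V where UV: "U \<in> \<Gamma>" "V \<in> \<Gamma>" "\<forall>w\<in>U. x + w \<in> S" "\<forall>w\<in>V. x + w \<in> T" by blast
    then obtain W where "W \<in> \<Gamma>" "W \<subseteq> U \<inter> V" using nbhd_base_Int by blast
    then show "\<exists>W\<in>\<Gamma>. \<forall>w\<in>W. x + w \<in> S \<inter> T"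
      using UV by (intro bexI[of _ W]) auto
  next
    fix \<K> x
    assume *: "\<forall>S\<in>\<K>. \<forall>x\<in>S. \<exists>W\<in>\<Gamma>. \<forall>w\<in>W. x + w \<in> S" and "x \<in> \<Union>\<K>"
    then obtain S where S: "S \<in> \<K>" "x \<in> S" by blast
    with * obtain W where "W \<in> \<Gamma>" "\<forall>w\<in>W. x + w \<in> S" by blast
    then show "\<exists>W\<in>\<Gamma>. \<forall>w\<in>W. x + w \<in> \<Union>\<K>"
      using S(1) by (intro bexI[of _ W]) auto
  qed
  from fun_cong[OF topology_inverse'[OF this]] show ?thesis unfolding translate_topology_def .
qed

lemma topspace_translate_topology: "topspace (translate_topology \<Gamma>) = UNIV"
proof -
  have "openin (translate_topology \<Gamma>) UNIV"
    using nbhd_base_ne by (auto simp: openin_translate_topology)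
  then show ?thesis using openin_subset by blast
qed

lemma translate_topology_nbhd:
  assumes "U \<in> \<Gamma>"
  obtains A where "openin (translate_topology \<Gamma>) A" "x \<in> A" "A \<subseteq> (+) x ` U"
proof
  \<comment> \<open>Members of \<open>\<Gamma>\<close> need not be open, so the witness is the
    interior of \<open>x + U\<close>; halving shows that it is open.\<close>
  let ?A = "{y. \<exists>W\<in>\<Gamma>. \<forall>w\<in>W. y + w \<in> (+) x ` U}"
  show "openin (translate_topology \<Gamma>) ?A"
    unfolding openin_translate_topology
  proof
    fix y assume "y \<in> ?A"
    then obtain W where W: "W \<in> \<Gamma>" "\<forall>w\<in>W. y + w \<in> (+) x ` U" by blast
    then obtain W' where "W' \<in> \<Gamma>" "\<forall>a\<in>W'. \<forall>b\<in>W'. a + b \<in> W" using nbhd_base_square by blast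
    moreover from this have "y + a \<in> ?A" if "a \<in> W'" for a
      using W that by (intro CollectI bexI[of _ W']) (simp_all add: add.assoc)
    ultimately show "\<exists>W\<in>\<Gamma>. \<forall>w\<in>W. y + w \<in> ?A" by blast
  qed
  show "x \<in> ?A" using assms by blast
  show "?A \<subseteq> (+) x ` U"
  proof
    fix y assume "y \<in> ?A"
    then obtain W where "W \<in> \<Gamma>" "\<forall>w\<in>W. y + w \<in> (+) x ` U" by blast
    then have "y + 0 \<in> (+) x ` U" using nbhd_base_zero by blast
    then show "y \<in> (+) x ` U" by simp
  qed
qed

lemma group_topology_translate_topology: "group_topology (translate_topology \<Gamma>)"
proof -
  let ?\<sigma> = "translate_topology \<Gamma>"
  have "openin (prod_topology ?\<sigma> ?\<sigma>) {p. fst p + snd p \<in> U}" if U: "openin ?\<sigma> U" for U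
    unfolding openin_prod_topology_alt
  proof (intro allI impI)
    fix x y assume "(x, y) \<in> {p. fst p + snd p \<in> U}"
    then obtain W where W: "W \<in> \<Gamma>" "\<forall>w\<in>W. x + y + w \<in> U"
      using U by (auto simp: openin_translate_topology)
    obtain W1 where W1: "W1 \<in> \<Gamma>" "\<forall>a\<in>W1. \<forall>b\<in>W1. a + b \<in> W" using nbhd_base_square[OF W(1)] by blast
    \<comment> \<open>Without commutativity, \<open>x + u + y + v\<close> is
      \<open>x + y + (- y + u + y) + v\<close>: conjugation by \<open>- y\<close> moves the error
      \<open>u\<close> past \<open>y\<close>.\<close>
    obtain W2 where W2: "W2 \<in> \<Gamma>" "\<forall>w\<in>W2. - y + w - (- y) \<in> W1" using nbhd_base_conj[OF W1(1)] by blast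
    obtain A where A: "openin ?\<sigma> A" "x \<in> A" "A \<subseteq> (+) x ` W2" using translate_topology_nbhd[OF W2(1)] .
    obtain B where B: "openin ?\<sigma> B" "y \<in> B" "B \<subseteq> (+) y ` W1" using translate_topology_nbhd[OF W1(1)] .
    have "a + b \<in> U" if ab: "a \<in> A" "b \<in> B" for a b
    proof -
      obtain u v where uv: "u \<in> W2" "v \<in> W1" "a = x + u" "b = y + v" using ab A(3) B(3) by blast
      then have "x + y + ((- y + u - (- y)) + v) \<in> U" using W W1 W2 by blast
      then show ?thesis using uv by (simp add: add.assoc)
    qed
    then show "\<exists>A B. openin ?\<sigma> A \<and> openin ?\<sigma> B \<and> x \<in> A \<and> y \<in> B \<and> A \<times> B \<subseteq> {p. fst p + snd p \<in> U}"
      using A B by (intro exI[of _ A] exI[of _ B]) auto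
  qed
  moreover have "openin ?\<sigma> {x. - x \<in> U}" if U: "openin ?\<sigma> U" for U
    unfolding openin_translate_topology
  proof
    fix x assume "x \<in> {x. - x \<in> U}"
    then obtain W where W: "W \<in> \<Gamma>" "\<forall>w\<in>W. - x + w \<in> U" using U by (auto simp: openin_translate_topology)
    obtain W1 where W1: "W1 \<in> \<Gamma>" "\<forall>a\<in>W1. \<forall>b\<in>W1. a - b \<in> W" using nbhd_base_square[OF W(1)] by blast
    obtain W2 where W2: "W2 \<in> \<Gamma>" "\<forall>w\<in>W2. x + w - x \<in> W1" using nbhd_base_conj[OF W1(1)] by blast
    have "- (x + w) \<in> U" if "w \<in> W2" for w
    proof -
      \<comment> \<open>This rewrites \<open>- (x + w)\<close> as an error added to
        \<open>- x\<close>; writing the negative as a difference from 0 makes the choice of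
        \<open>W1\<close> applicable.\<close>
      have "- x + (0 - (x + w - x)) \<in> U" using that W W1 W2 nbhd_base_zero by blast
      then show ?thesis by (simp add: add.assoc[symmetric] minus_add diff_conv_add_uminus del: add_uminus_conv_diff)
    qed
    then show "\<exists>W\<in>\<Gamma>. \<forall>w\<in>W. x + w \<in> {x. - x \<in> U}" using W2 by blast
  qed
  ultimately show ?thesis
    by (auto simp: group_topology_def topspace_translate_topology continuous_map_def case_prod_unfold)
qed

text \<open>Take a member missing \<open>- x + y\<close> and \<open>W\<close> with
  \<open>W - W\<close> inside that member: a common point of \<open>x + W\<close> and
  \<open>y + W\<close> would put \<open>- x + y\<close> into \<open>W - W\<close>.\<close>

lemma Hausdorff_translate_topology:
  assumes "\<And>x. x \<noteq> 0 \<Longrightarrow> \<exists>U\<in>\<Gamma>. x \<notin> U"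
  shows "Hausdorff_space (translate_topology \<Gamma>)"
  unfolding Hausdorff_space_def
proof (intro allI impI, elim conjE)
  fix x y :: 'a assume "x \<noteq> y"
  then have "- x + y \<noteq> 0" by (simp add: eq_neg_iff_add_eq_0[symmetric])
  then obtain U where U: "U \<in> \<Gamma>" "- x + y \<notin> U" using assms by blast
  obtain W where W: "W \<in> \<Gamma>" "\<forall>a\<in>W. \<forall>b\<in>W. a - b \<in> U" using nbhd_base_square[OF U(1)] by blast
  obtain A where A: "openin (translate_topology \<Gamma>) A" "x \<in> A" "A \<subseteq> (+) x ` W" using translate_topology_nbhd[OF W(1)] .
  obtain B where B: "openin (translate_topology \<Gamma>) B" "y \<in> B" "B \<subseteq> (+) y ` W" using translate_topology_nbhd[OF W(1)] .
  have "disjnt A B"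
    unfolding disjnt_iff
  proof (intro allI notI, elim conjE)
    fix z assume "z \<in> A" "z \<in> B"
    then obtain a b where ab: "a \<in> W" "b \<in> W" "z = x + a" "z = y + b" using A B by blast
    then have "y = x + (a - b)" by (simp add: eq_diff_eq add_diff_eq)
    then have "- x + y = a - b" by simp
    then show False using ab W U by simp
  qed
  then show "\<exists>U V. openin (translate_topology \<Gamma>) U \<and> openin (translate_topology \<Gamma>) V \<and> x \<in> U \<and> y \<in> V \<and> disjnt U V"
    using A B by blast
qed

end

lemma coarser_translate_topology:
  assumes "group_topology \<tau>" "nbhd_base_at_zero \<Gamma>" "\<And>U. U \<in> \<Gamma> \<Longrightarrow> openin \<tau> U"
  shows "coarser_topology (translate_topology \<Gamma>) \<tau>"
  unfolding coarser_topology_def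
proof (intro allI impI)
  fix U assume U: "openin (translate_topology \<Gamma>) U"
  show "openin \<tau> U"
  proof (subst openin_subopen, intro ballI)
    fix x assume "x \<in> U"
    then obtain W where W: "W \<in> \<Gamma>" "\<forall>w\<in>W. x + w \<in> U"
      using U openin_translate_topology[OF assms(2)] by blast
    moreover have "x \<in> (+) x ` W"
      using nbhd_base_zero[OF assms(2) W(1)] by (force intro: image_eqI[of _ _ 0])
    ultimately show "\<exists>T. openin \<tau> T \<and> x \<in> T \<and> T \<subseteq> U"
      using group_topology_translate_open[OF assms(1) assms(3)[OF W(1)]] by (intro exI[of _ "(+) x ` W"]) auto
  qed
qed

section \<open>Small neighbourhood bases from a network\<close>

text \<open>The closure is the union of countably many stages, and an infinite cardinal absorbs
  squares and unions over index sets no larger than itself. A binary set-valued \<open>S\<close>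
  covers intersections and whole families of new sets at once. Leastness lets properties be
  transferred from the generators to \<open>C\<close>.\<close>

lemma least_closed_superset_card:
  assumes "infinite N" "|A| \<le>o |N|" "\<And>x y. |S x y| \<le>o |N|"
  obtains C where "A \<subseteq> C" "|C| \<le>o |N|" "\<And>x y. x \<in> C \<Longrightarrow> y \<in> C \<Longrightarrow> S x y \<subseteq> C"
    "\<And>D. A \<subseteq> D \<Longrightarrow> (\<And>x y. x \<in> D \<Longrightarrow> y \<in> D \<Longrightarrow> S x y \<subseteq> D) \<Longrightarrow> C \<subseteq> D"
proof -
  define step where "step X = X \<union> (\<Union>p\<in>X \<times> X. S (fst p) (snd p))" for X
  define C where "C n = (step ^^ n) A" for n
  have C0: "C 0 = A" and CS: "C (Suc n) = step (C n)" for n by (auto simp: C_def)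
  have card: "|C n| \<le>o |N|" for n
  proof (induction n)
    case (Suc n)
    have "|C n \<times> C n| \<le>o |N|"
      by (intro card_of_Sigma_ordLeq_infinite assms(1) Suc ballI)
    then have "|\<Union>p\<in>C n \<times> C n. S (fst p) (snd p)| \<le>o |N|"
      by (intro card_of_UNION_ordLeq_infinite assms ballI)
    then show ?case
      unfolding CS step_def using Suc assms(1)
      by (intro card_of_Un_ordLeq_infinite_Field) (simp_all add: Field_card_of card_of_card_order_on)
  qed (simp add: C0 assms)
  have mono: "C m \<subseteq> C n" if "m \<le> n" for m n
    using that by (induction rule: dec_induct) (auto simp: CS step_def)
  show thesis
  proof
    show "A \<subseteq> (\<Union>n. C n)" using C0 by blast
    show "|\<Union>n. C n| \<le>o |N|"
      using assms(1) card
      by (intro card_of_UNION_ordLeq_infinite) (simp_all add: infinite_iff_card_of_nat)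
  next
    fix x y assume "x \<in> (\<Union>n. C n)" "y \<in> (\<Union>n. C n)"
    then obtain m n where "x \<in> C m" "y \<in> C n" by blast
    then have "x \<in> C (max m n)" "y \<in> C (max m n)" using mono by (meson max.cobounded1 max.cobounded2 subsetD)+
    then have "S x y \<subseteq> C (Suc (max m n))" unfolding CS step_def by force
    then show "S x y \<subseteq> (\<Union>n. C n)" by blast
  next
    fix D assume D: "A \<subseteq> D" "\<And>x y. x \<in> D \<Longrightarrow> y \<in> D \<Longrightarrow> S x y \<subseteq> D"
    have "C n \<subseteq> D" for n
    proof (induction n)
      case (Suc n)
      then show ?case unfolding CS step_def using D(2) by fastforce
    qed (simp add: C0 D)
    then show "(\<Union>n. C n) \<subseteq> D" by blast
  qed
qed

text \<open>Only those network members that lie in a right translate \<open>V + f\<close> matter: on such a member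
  conjugation is controlled uniformly, so one neighbourhood per member suffices.\<close>

lemma network_conj_nbhds:
  assumes "group_topology \<tau>" "network_of \<tau> \<N>" "openin \<tau> U" "0 \<in> U"
  shows "\<exists>K. (\<forall>N. openin \<tau> (K N) \<and> 0 \<in> K N) \<and> (\<forall>g. \<exists>N\<in>\<N>. \<forall>w\<in>K N. g + w - g \<in> U)"
proof -
  \<comment> \<open>For \<open>g = v + f\<close> the conjugate \<open>g + w - g\<close> becomes
    \<open>v + (f + w - f) - v\<close>; two nested choices, \<open>V + V\<close> inside
    \<open>V1\<close> and \<open>V1 - V1\<close> inside \<open>U\<close>, absorb both occurrences of
    \<open>v\<close>.\<close>
  obtain V1 where V1: "openin \<tau> V1" "0 \<in> V1" "\<forall>a\<in>V1. \<forall>b\<in>V1. a - b \<in> U"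
    using group_topology_square_nbhd[OF assms(1,3,4)] by blast
  obtain V where V: "openin \<tau> V" "0 \<in> V" "\<forall>a\<in>V. \<forall>b\<in>V. a + b \<in> V1"
    using group_topology_square_nbhd[OF assms(1) V1(1,2)] by blast
  have "\<exists>W. openin \<tau> W \<and> 0 \<in> W \<and>
      ((\<exists>f. N \<subseteq> (\<lambda>v. v + f) ` V) \<longrightarrow> (\<forall>g\<in>N. \<forall>w\<in>W. g + w - g \<in> U))" for N
  proof (cases "\<exists>f. N \<subseteq> (\<lambda>v. v + f) ` V")
    case True
    then obtain f where f: "N \<subseteq> (\<lambda>v. v + f) ` V" by blast
    obtain W where W: "openin \<tau> W" "0 \<in> W" "\<forall>w\<in>W. f + w - f \<in> V"
      using group_topology_conj_nbhd[OF assms(1) V(1,2)] by blast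
    have "g + w - g \<in> U" if "g \<in> N" "w \<in> W" for g w
    proof -
      obtain v where v: "v \<in> V" "g = v + f" using f \<open>g \<in> N\<close> by blast
      have "v + (f + w - f) \<in> V1" "v + 0 \<in> V1" using v W V that by blast+
      then have "v + (f + w - f) - v \<in> U" using V1 by simp
      then show ?thesis using v by (simp add: add.assoc minus_add diff_conv_add_uminus del: add_uminus_conv_diff)
    qed
    then show ?thesis using W by blast
  next
    case False
    \<comment> \<open>A member in no right translate of \<open>V\<close> imposes no condition, so
      \<open>U\<close> itself serves as a default.\<close>
    then show ?thesis using assms(3,4) by blast
  qed
  then obtain K where K: "\<And>N. openin \<tau> (K N) \<and> 0 \<in> K N \<and>
      ((\<exists>f. N \<subseteq> (\<lambda>v. v + f) ` V) \<longrightarrow> (\<forall>g\<in>N. \<forall>w\<in>K N. g + w - g \<in> U))" by metis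
  have "\<exists>N\<in>\<N>. \<forall>w\<in>K N. g + w - g \<in> U" for g
  proof -
    \<comment> \<open>Translating \<open>V\<close> by \<open>g\<close> itself yields a member around
      \<open>g\<close> that is among the controlled ones.\<close>
    have "openin \<tau> ((\<lambda>v. v + g) ` V)" "g \<in> (\<lambda>v. v + g) ` V"
      using group_topology_translate_right_open[OF assms(1) V(1)] V(2) by (auto intro: image_eqI[of _ _ 0])
    then obtain N where "N \<in> \<N>" "g \<in> N" "N \<subseteq> (\<lambda>v. v + g) ` V"
      using assms(2) unfolding network_of_def by meson
    then show ?thesis using K by blast
  qed
  then show ?thesis using K by blast
qed

text \<open>Each member \<open>N\<close> gets a neighbourhood of \<open>z\<close> missing it, if
  there is one. For \<open>x \<noteq> z\<close>, disjoint neighbourhoods of \<open>z\<close> and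
  \<open>x\<close> provide a member \<open>N\<close> around \<open>x\<close> inside the second, and
  then \<open>S N\<close> misses \<open>x\<close>.\<close>

lemma network_separating_nbhds:
  assumes "topspace X = UNIV" "Hausdorff_space X" "network_of X \<N>"
  shows "\<exists>S. (\<forall>N. openin X (S N) \<and> z \<in> S N) \<and> (\<forall>x. x \<noteq> z \<longrightarrow> (\<exists>N\<in>\<N>. x \<notin> S N))"
proof -
  \<comment> \<open>The whole space is the default for members that meet every neighbourhood of
    \<open>z\<close>.\<close>
  have "openin X UNIV" using openin_topspace[of X] assms(1) by simp
  then have "\<exists>U. openin X U \<and> z \<in> U \<and> ((\<exists>V. openin X V \<and> z \<in> V \<and> V \<inter> N = {}) \<longrightarrow> U \<inter> N = {})" for N
    by blast
  then obtain S where S: "\<And>N. openin X (S N) \<and> z \<in> S N \<and>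
      ((\<exists>V. openin X V \<and> z \<in> V \<and> V \<inter> N = {}) \<longrightarrow> S N \<inter> N = {})" by metis
  have "\<exists>N\<in>\<N>. x \<notin> S N" if "x \<noteq> z" for x
  proof -
    obtain V W where VW: "openin X V" "openin X W" "z \<in> V" "x \<in> W" "disjnt V W"
      using assms(1,2) \<open>x \<noteq> z\<close> unfolding Hausdorff_space_def by (metis UNIV_I)
    then obtain N where "N \<in> \<N>" "x \<in> N" "N \<subseteq> W"
      using assms(3) unfolding network_of_def by meson
    moreover from this have "V \<inter> N = {}" using VW by (auto simp: disjnt_def)
    then have "S N \<inter> N = {}" using S[of N] VW by blast
    ultimately show ?thesis by blast
  qed
  then show ?thesis using S by (intro exI[of _ S]) simp
qed

lemma network_imp_small_nbhd_base:
  assumes \<tau>: "group_topology \<tau>" "Hausdorff_space \<tau>" and net: "network_of \<tau> \<N>" "infinite \<N>"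
    and U0: "openin \<tau> U0" "0 \<in> U0"
  obtains \<Gamma> where "nbhd_base_at_zero \<Gamma>" "|\<Gamma>| \<le>o |\<N>|" "U0 \<in> \<Gamma>"
    "\<And>U. U \<in> \<Gamma> \<Longrightarrow> openin \<tau> U" "\<And>x. x \<noteq> 0 \<Longrightarrow> \<exists>U\<in>\<Gamma>. x \<notin> U"
proof -
  define nb where "nb = {U. openin \<tau> U \<and> (0::'a) \<in> U}"
  have "\<forall>U\<in>nb. \<exists>W. W \<in> nb \<and> (\<forall>a\<in>W. \<forall>b\<in>W. a + b \<in> U \<and> a - b \<in> U)"
    unfolding nb_def using group_topology_square_nbhd[OF \<tau>(1)] by blast
  then obtain H where H: "\<And>U. U \<in> nb \<Longrightarrow> H U \<in> nb \<and> (\<forall>a\<in>H U. \<forall>b\<in>H U. a + b \<in> U \<and> a - b \<in> U)" by metis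
  have "\<forall>U\<in>nb. \<exists>K. (\<forall>N. K N \<in> nb) \<and> (\<forall>g. \<exists>N\<in>\<N>. \<forall>w\<in>K N. g + w - g \<in> U)"
    using network_conj_nbhds[OF \<tau>(1) net(1)] by (simp add: nb_def)
  from bchoice[OF this] obtain K where
    "\<forall>U\<in>nb. (\<forall>N. K U N \<in> nb) \<and> (\<forall>g. \<exists>N\<in>\<N>. \<forall>w\<in>K U N. g + w - g \<in> U)" ..
  note K = bspec[OF this]
  obtain S where S: "\<And>N. S N \<in> nb" "\<And>x. x \<noteq> 0 \<Longrightarrow> \<exists>N\<in>\<N>. x \<notin> S N"
    using network_separating_nbhds[OF _ \<tau>(2) net(1), of 0] \<tau>(1)
    by (auto simp: nb_def group_topology_def simp del: not_all not_ex)
  \<comment> \<open>The generators and the sets added in one step both have the form of a finite set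
    together with an image of \<open>\<N>\<close>, so this bound meets both size conditions of the
    closure lemma.\<close>
  have fin: "|F \<union> f ` \<N>| \<le>o |\<N>|" if "finite F" for F :: "'a set set" and f
    using net(2) that
    by (intro card_of_Un_ordLeq_infinite_Field)
      (simp_all add: Field_card_of card_of_card_order_on card_of_image ordLeq3_finite_infinite)
  obtain \<Gamma> where \<Gamma>: "{U0} \<union> S ` \<N> \<subseteq> \<Gamma>" "|\<Gamma>| \<le>o |\<N>|"
    "\<And>U V. U \<in> \<Gamma> \<Longrightarrow> V \<in> \<Gamma> \<Longrightarrow> {H U, U \<inter> V} \<union> K U ` \<N> \<subseteq> \<Gamma>"
    "\<And>D. {U0} \<union> S ` \<N> \<subseteq> D \<Longrightarrow> (\<And>U V. U \<in> D \<Longrightarrow> V \<in> D \<Longrightarrow> {H U, U \<inter> V} \<union> K U ` \<N> \<subseteq> D) \<Longrightarrow> \<Gamma> \<subseteq> D"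
    by (rule least_closed_superset_card[OF net(2), of "{U0} \<union> S ` \<N>" "\<lambda>U V. {H U, U \<inter> V} \<union> K U ` \<N>"])
      (intro fin finite.intros | blast)+
  \<comment> \<open>\<open>nb\<close> contains the generators and is closed under the same
    operations, so leastness applies.\<close>
  have nb: "\<Gamma> \<subseteq> nb"
  proof (rule \<Gamma>(4))
    show "{U0} \<union> S ` \<N> \<subseteq> nb" using U0 S by (auto simp: nb_def)
    show "{H U, U \<inter> V} \<union> K U ` \<N> \<subseteq> nb" if "U \<in> nb" "V \<in> nb" for U V
    proof -
      have "U \<inter> V \<in> nb" using that by (auto simp: nb_def)
      then show ?thesis using H K that by blast
    qed
  qed
  show thesis
  proof
    show "nbhd_base_at_zero \<Gamma>"
      unfolding nbhd_base_at_zero_def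
    proof (intro conjI ballI allI)
      show "\<Gamma> \<noteq> {}" using \<Gamma>(1) by blast
    next
      fix U assume U: "U \<in> \<Gamma>"
      then have "U \<in> nb" using nb by blast
      then show "0 \<in> U" by (simp add: nb_def)
      have "H U \<in> \<Gamma>" using \<Gamma>(3)[OF U U] by simp
      then show "\<exists>W\<in>\<Gamma>. \<forall>a\<in>W. \<forall>b\<in>W. a + b \<in> U \<and> a - b \<in> U"
        using H[OF \<open>U \<in> nb\<close>] by (intro bexI[of _ "H U"]) auto
      show "\<exists>W\<in>\<Gamma>. \<forall>w\<in>W. g + w - g \<in> U" for g
      proof -
        obtain N where N: "N \<in> \<N>" "\<forall>w\<in>K U N. g + w - g \<in> U"
          using K[OF \<open>U \<in> nb\<close>] by blast
        have "K U N \<in> \<Gamma>" using \<Gamma>(3)[OF U U] N(1) by auto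
        then show ?thesis using N(2) by (intro bexI[of _ "K U N"])
      qed
      show "\<exists>W\<in>\<Gamma>. W \<subseteq> U \<inter> V" if "V \<in> \<Gamma>" for V
        using \<Gamma>(3)[OF U that] by (intro bexI[of _ "U \<inter> V"]) auto
    qed
    show "\<exists>U\<in>\<Gamma>. x \<notin> U" if "x \<noteq> 0" for x
      using S(2)[OF that] \<Gamma>(1) by blast
  qed (use \<Gamma> nb in \<open>auto simp: nb_def\<close>)
qed

section \<open>From neighbourhood bases to weight and netweight\<close>

text \<open>A dense point near \<open>x\<close> replaces \<open>x\<close> as centre: if
  \<open>d = x + c\<close> with \<open>c \<in> W2\<close>, then \<open>d + W1\<close> still contains
  \<open>x\<close> and stays inside \<open>x + W\<close>.\<close>

lemma basis_of_dense_translates: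
  assumes \<tau>: "group_topology \<tau>" and \<Gamma>: "nbhd_base_at_zero \<Gamma>" "\<tau> = translate_topology \<Gamma>"
    and op: "\<And>U. U \<in> \<Gamma> \<Longrightarrow> openin \<tau> U"
    and dense: "\<And>U. openin \<tau> U \<Longrightarrow> U \<noteq> {} \<Longrightarrow> U \<inter> D \<noteq> {}"
  shows "basis_of \<tau> ((\<lambda>(d, W). (+) d ` W) ` (D \<times> \<Gamma>))"
  unfolding basis_of_def
proof (intro conjI ballI allI impI)
  show "openin \<tau> B" if "B \<in> (\<lambda>(d, W). (+) d ` W) ` (D \<times> \<Gamma>)" for B
    using that op group_topology_translate_open[OF \<tau>] by auto
next
  fix x U assume "openin \<tau> U \<and> x \<in> U"
  then obtain W where W: "W \<in> \<Gamma>" "\<forall>w\<in>W. x + w \<in> U"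
    using openin_translate_topology[OF \<Gamma>(1)] \<Gamma>(2) by blast
  obtain W1 where W1: "W1 \<in> \<Gamma>" "\<forall>a\<in>W1. \<forall>b\<in>W1. a + b \<in> W \<and> a - b \<in> W"
    using nbhd_base_square[OF \<Gamma>(1) W(1)] by blast
  obtain W2 where W2: "W2 \<in> \<Gamma>" "\<forall>a\<in>W2. \<forall>b\<in>W2. a + b \<in> W1 \<and> a - b \<in> W1"
    using nbhd_base_square[OF \<Gamma>(1) W1(1)] by blast
  have zero: "0 \<in> W2" using nbhd_base_zero[OF \<Gamma>(1) W2(1)] .
  then obtain d where "d \<in> (+) x ` W2" "d \<in> D"
    using dense[OF group_topology_translate_open[OF \<tau> op[OF W2(1)], of x]] by blast
  then obtain c where c: "c \<in> W2" "d = x + c" by blast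
  \<comment> \<open>Here \<open>- c\<close> is read as \<open>0 - c\<close> and \<open>c\<close> as
    \<open>c + 0\<close>, both covered by the choice of \<open>W2\<close>.\<close>
  have mc: "- c \<in> W1" "c \<in> W1" using W2(2) zero c by (metis diff_0, metis add.right_neutral)
  have "x \<in> (+) d ` W1" using mc c by (intro image_eqI[of _ _ "- c"]) (auto simp: add.assoc)
  moreover have "(+) d ` W1 \<subseteq> U" using c mc W W1 by (auto simp: add.assoc)
  ultimately show "\<exists>B\<in>(\<lambda>(d, W). (+) d ` W) ` (D \<times> \<Gamma>). x \<in> B \<and> B \<subseteq> U"
    using \<open>d \<in> D\<close> W1(1) by (intro bexI[of _ "(+) d ` W1"]) auto
qed

lemma locally_minimal_basis_le_network:
  assumes lm: "locally_minimal \<tau>" and net: "network_of \<tau> \<N>" "infinite \<N>"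
  obtains \<B> where "basis_of \<tau> \<B>" "|\<B>| \<le>o |\<N>|"
proof -
  obtain V where \<tau>: "group_topology \<tau>" "Hausdorff_space \<tau>" and "nbhd_of \<tau> 0 V" and
    min: "\<And>\<sigma>. group_topology \<sigma> \<Longrightarrow> Hausdorff_space \<sigma> \<Longrightarrow> coarser_topology \<sigma> \<tau> \<Longrightarrow> nbhd_of \<sigma> 0 V \<Longrightarrow> \<sigma> = \<tau>"
    using lm by (auto simp: locally_minimal_def)
  then obtain U0 where U0: "openin \<tau> U0" "0 \<in> U0" "U0 \<subseteq> V" by (auto simp: nbhd_of_def)
  obtain \<Gamma> where \<Gamma>: "nbhd_base_at_zero \<Gamma>" "|\<Gamma>| \<le>o |\<N>|" "U0 \<in> \<Gamma>"
    "\<And>U. U \<in> \<Gamma> \<Longrightarrow> openin \<tau> U" "\<And>x. x \<noteq> 0 \<Longrightarrow> \<exists>U\<in>\<Gamma>. x \<notin> U"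
    using network_imp_small_nbhd_base[OF \<tau> net U0(1,2)] by blast
  \<comment> \<open>Membership of \<open>U0\<close> in \<open>\<Gamma>\<close> keeps
    \<open>V\<close> a neighbourhood of 0 in the coarser topology, which is what local minimality
    requires.\<close>
  obtain A where A: "openin (translate_topology \<Gamma>) A" "0 \<in> A" "A \<subseteq> (+) 0 ` U0"
    using translate_topology_nbhd[OF \<Gamma>(1,3)] .
  have "nbhd_of (translate_topology \<Gamma>) 0 V"
    using A U0(3) by (auto simp: nbhd_of_def topspace_translate_topology[OF \<Gamma>(1)] intro!: exI[of _ A])
  then have eq: "\<tau> = translate_topology \<Gamma>"
    using min group_topology_translate_topology[OF \<Gamma>(1)] Hausdorff_translate_topology[OF \<Gamma>(1,5)]
      coarser_translate_topology[OF \<tau>(1) \<Gamma>(1,4)] by blast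
  \<comment> \<open>An empty member contributes an arbitrary point, which is harmless:
    \<open>D\<close> only has to meet every nonempty open set.\<close>
  define D where "D = (\<lambda>N. SOME x. x \<in> N) ` \<N>"
  have dense: "U \<inter> D \<noteq> {}" if U: "openin \<tau> U" "U \<noteq> {}" for U
  proof -
    obtain N x where N: "N \<in> \<N>" "x \<in> N" "N \<subseteq> U" using U net(1) unfolding network_of_def by (metis ex_in_conv)
    then have "(SOME x. x \<in> N) \<in> N" by (meson someI)
    then show ?thesis using N D_def by blast
  qed
  have "|D| \<le>o |\<N>|" unfolding D_def by (rule card_of_image)
  then have "|D \<times> \<Gamma>| \<le>o |\<N>|"
    by (intro card_of_Sigma_ordLeq_infinite net(2) \<Gamma>(2) ballI)
  then have "|(\<lambda>(d, W). (+) d ` W) ` (D \<times> \<Gamma>)| \<le>o |\<N>|"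
    using card_of_image ordLeq_transitive by blast
  then show thesis using that basis_of_dense_translates[OF \<tau>(1) \<Gamma>(1) eq \<Gamma>(4) dense] by blast
qed

text \<open>Cardinal absorption fails for finite networks, and finite weights are not rounded up, so
  this case is settled exactly. Points of a Hausdorff space are told apart by the members containing
  them, so the space is finite and discrete; its singletons form a basis and each of them must
  belong to the network.\<close>

lemma finite_network_imp_basis:
  assumes "Hausdorff_space X" "network_of X \<N>" "finite \<N>"
  obtains \<B> where "basis_of X \<B>" "|\<B>| \<le>o |\<N>|"
proof -
  have "inj_on (\<lambda>x. {N \<in> \<N>. x \<in> N}) (topspace X)"
  proof (intro inj_onI, rule ccontr)
    fix x y assume xy: "x \<in> topspace X" "y \<in> topspace X" "{N \<in> \<N>. x \<in> N} = {N \<in> \<N>. y \<in> N}" "x \<noteq> y"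
    then obtain U V where "openin X U" "x \<in> U" "y \<in> V" "disjnt U V"
      using assms(1) unfolding Hausdorff_space_def by metis
    then show False using assms(2) xy(3) unfolding network_of_def disjnt_iff
      by (smt (verit, ccfv_threshold) mem_Collect_eq subsetD)
  qed
  then have "finite (topspace X)"
    by (rule inj_on_finite[of _ _ "Pow \<N>"]) (use assms(3) in auto)
  then have X: "X = discrete_topology (topspace X)"
    using finite_topspace_imp_discrete_topology assms(1) by blast
  have op: "openin X U" if "U \<subseteq> topspace X" for U
    using that by (subst X) simp
  define \<B> where "\<B> = (\<lambda>x. {x}) ` topspace X"
  have "basis_of X \<B>"
    unfolding basis_of_def \<B>_def using op openin_subset by fastforce
  moreover have "\<B> \<subseteq> \<N>"
  proof
    fix B assume "B \<in> \<B>"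
    then obtain x where x: "B = {x}" "x \<in> topspace X" by (auto simp: \<B>_def)
    then obtain N where "N \<in> \<N>" "x \<in> N" "N \<subseteq> {x}"
      using op[of "{x}"] assms(2) unfolding network_of_def by (metis empty_subsetI insert_subset singletonI)
    then show "B \<in> \<N>" using x by (metis subset_singletonD empty_iff)
  qed
  ultimately show thesis using that card_of_mono1 by blast
qed

lemma basis_of_imp_network_of: "basis_of X \<B> \<Longrightarrow> network_of X \<B>"
  using openin_subset by (auto simp: basis_of_def network_of_def)

lemma locally_minimal_weight_eq_netweight:
  assumes "locally_minimal \<tau>"
  shows "weight \<tau> =o netweight \<tau>"
proof -
  obtain \<B> where B: "basis_of \<tau> \<B>" "weight \<tau> = |\<B>|" "\<And>\<C>. basis_of \<tau> \<C> \<Longrightarrow> |\<B>| \<le>o |\<C>|"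
    using weight_witness[of \<tau>] by blast
  obtain \<N> where N: "network_of \<tau> \<N>" "netweight \<tau> = |\<N>|" "\<And>\<M>. network_of \<tau> \<M> \<Longrightarrow> |\<N>| \<le>o |\<M>|"
    using netweight_witness[of \<tau>] by blast
  have "Hausdorff_space \<tau>" using assms by (simp add: locally_minimal_def)
  \<comment> \<open>The infinite case uses local minimality, the finite one only the Hausdorff
    property.\<close>
  then obtain \<C> where "basis_of \<tau> \<C>" "|\<C>| \<le>o |\<N>|"
    using locally_minimal_basis_le_network[OF assms N(1)] finite_network_imp_basis[OF _ N(1)] by metis
  then have "|\<B>| \<le>o |\<N>|" using B(3) ordLeq_transitive by blast
  moreover have "|\<N>| \<le>o |\<B>|" using N(3) basis_of_imp_network_of[OF B(1)] by blast
  ultimately show ?thesis by (simp add: B(2) N(2) ordIso_iff_ordLeq)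
qed

section \<open>Metrization and the countable case\<close>

text \<open>The Urysohn functions of the countably many pairs of basic
  open sets \<open>(U, V)\<close> with the closure of \<open>U\<close> inside \<open>V\<close> embed the space into a countable power of
  the real line.\<close>

lemma second_countable_regular_imp_metrizable_space:
  assumes "second_countable X" "regular_space X" "Hausdorff_space X"
  shows "metrizable_space X"
proof -
  obtain \<B> where B: "countable \<B>" "\<And>V. V \<in> \<B> \<Longrightarrow> openin X V"
    "\<And>U x. openin X U \<Longrightarrow> x \<in> U \<Longrightarrow> \<exists>V\<in>\<B>. x \<in> V \<and> V \<subseteq> U"
    using assms(1) unfolding second_countable_def by metis
  have normal: "normal_space X"
    using regular_Lindelof_imp_normal_space assms second_countable_imp_Lindelof_space by blast
  define I where "I = {(U, V). U \<in> \<B> \<and> V \<in> \<B> \<and> X closure_of U \<subseteq> V}"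
  have "countable I" by (rule countable_subset[of _ "\<B> \<times> \<B>"]) (use B(1) in \<open>auto simp: I_def\<close>)
  have "\<exists>f. continuous_map X euclideanreal f \<and> f ` (X closure_of fst p) \<subseteq> {0} \<and> f ` (topspace X - snd p) \<subseteq> {1}"
    if "p \<in> I" for p
  proof -
    have "openin X (snd p)" "X closure_of fst p \<subseteq> snd p" using that B(2) by (auto simp: I_def)
    then show ?thesis
      by (rule_tac Urysohn_lemma_alt[OF normal, of "X closure_of fst p" "topspace X - snd p" 0 1])
        (blast | auto simp: disjnt_iff)+
  qed
  then obtain f where f': "\<And>p. p \<in> I \<Longrightarrow> continuous_map X euclideanreal (f p) \<and>
      f p ` (X closure_of fst p) \<subseteq> {0} \<and> f p ` (topspace X - snd p) \<subseteq> {1}"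
    by metis
  then have f: "\<And>p. p \<in> I \<Longrightarrow> continuous_map X euclideanreal (f p)"
    "\<And>p x. p \<in> I \<Longrightarrow> x \<in> X closure_of fst p \<Longrightarrow> f p x = 0"
    "\<And>p x. p \<in> I \<Longrightarrow> x \<in> topspace X - snd p \<Longrightarrow> f p x = 1"
    by blast+
  \<comment> \<open>Regularity squeezes a closed set between \<open>x\<close> and a basic
    \<open>V\<close> inside \<open>U\<close>; a basic \<open>W\<close> below it gives a pair in
    \<open>I\<close> whose function is 0 at \<open>x\<close> and 1 off \<open>U\<close>.\<close>
  have sep: "\<exists>p\<in>I. f p x = 0 \<and> (\<forall>y\<in>topspace X - U. f p y = 1)" if U: "openin X U" "x \<in> U" for U x
  proof -
    obtain V where V: "V \<in> \<B>" "x \<in> V" "V \<subseteq> U" using B(3)[OF U] by blast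
    obtain A C where A: "openin X A" "closedin X C" "x \<in> A" "A \<subseteq> C" "C \<subseteq> V"
      using assms(2) B(2)[OF V(1)] V(2) unfolding neighbourhood_base_of_closedin[symmetric] neighbourhood_base_of by metis
    obtain W where W: "W \<in> \<B>" "x \<in> W" "W \<subseteq> A" using B(3)[OF A(1,3)] by blast
    have "X closure_of W \<subseteq> V" using W A by (meson closure_of_minimal order_trans)
    then have p: "(W, V) \<in> I" using W V by (simp add: I_def)
    have "x \<in> X closure_of W" using W B(2) closure_of_subset openin_subset by (metis subsetD)
    then show ?thesis using f(2,3)[OF p] V(3) by (intro bexI[OF _ p]) auto
  qed
  define Y where "Y = product_topology (\<lambda>_. euclideanreal) I"
  define e where "e x = (\<lambda>p\<in>I. f p x)" for x
  have "e x \<noteq> e y" if xy: "x \<in> topspace X" "y \<in> topspace X" "x \<noteq> y" for x y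
  proof -
    obtain U V where "openin X U" "x \<in> U" "y \<in> V" "disjnt U V"
      using xy assms(3) unfolding Hausdorff_space_def by metis
    then obtain p where "p \<in> I" "f p x = 0" "f p y = 1" using sep[of U x] xy by (auto simp: disjnt_iff)
    then show ?thesis unfolding e_def by (metis restrict_apply' zero_neq_one)
  qed
  then have inj: "inj_on e (topspace X)" by (meson inj_onI)
  have cont: "continuous_map X (subtopology Y (e ` topspace X)) e"
    unfolding Y_def e_def using f(1) by (auto simp: continuous_map_in_subtopology continuous_map_componentwise)
  have "openin (subtopology Y (e ` topspace X)) (e ` U)" if U: "openin X U" for U
  proof (subst openin_subopen, clarify)
    fix x assume x: "x \<in> U"
    then obtain p where p: "p \<in> I" "f p x = 0" "\<forall>y\<in>topspace X - U. f p y = 1" using sep[OF U] by blast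
    have "openin Y {z \<in> topspace Y. z p \<in> {..<1}}"
      using p(1) unfolding Y_def by (intro openin_continuous_map_preimage[OF continuous_map_product_projection]) auto
    then have "openin (subtopology Y (e ` topspace X)) ({z \<in> topspace Y. z p \<in> {..<1}} \<inter> e ` topspace X)"
      by (simp add: openin_subtopology_Int)
    moreover have "e x \<in> {z \<in> topspace Y. z p \<in> {..<1}} \<inter> e ` topspace X"
      using x p openin_subset[OF U] by (auto simp: Y_def e_def)
    moreover have "{z \<in> topspace Y. z p \<in> {..<1}} \<inter> e ` topspace X \<subseteq> e ` U"
      using p by (force simp: e_def)
    ultimately show "\<exists>T. openin (subtopology Y (e ` topspace X)) T \<and> e x \<in> T \<and> T \<subseteq> e ` U" by blast
  qed
  then have "open_map X (subtopology Y (e ` topspace X)) e" by (simp add: open_map_def)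
  moreover have "topspace (subtopology Y (e ` topspace X)) = e ` topspace X"
    by (auto simp: Y_def e_def)
  ultimately have "homeomorphic_map X (subtopology Y (e ` topspace X)) e"
    using cont inj by (intro bijective_open_imp_homeomorphic_map) auto
  then have "X homeomorphic_space subtopology Y (e ` topspace X)"
    using homeomorphic_map_imp_homeomorphic_space by blast
  moreover have "metrizable_space Y"
    unfolding Y_def metrizable_space_product_topology
    using \<open>countable I\<close> metrizable_space_euclidean by (auto intro: countable_subset[of _ I])
  ultimately show ?thesis
    using homeomorphic_metrizable_space metrizable_space_subtopology by blast
qed

theorem theorem2p8:
  fixes \<tau> :: "'a::group_add topology"
  assumes "locally_minimal \<tau>"
  shows "weight \<tau> =o netweight \<tau> \<and> (countable (UNIV :: 'a set) \<longrightarrow> metrizable_space \<tau>)"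
proof (intro conjI impI)
  show eq: "weight \<tau> =o netweight \<tau>"
    using locally_minimal_weight_eq_netweight[OF assms] .
  assume count: "countable (UNIV :: 'a set)"
  have \<tau>: "group_topology \<tau>" "Hausdorff_space \<tau>" using assms by (auto simp: locally_minimal_def)
  obtain \<B> where B: "basis_of \<tau> \<B>" "weight \<tau> = |\<B>|"
    by (rule weight_witness[of \<tau>])
  obtain \<N> where N: "network_of \<tau> \<N>" "netweight \<tau> = |\<N>|" "\<And>\<M>. network_of \<tau> \<M> \<Longrightarrow> |\<N>| \<le>o |\<M>|"
    using netweight_witness[of \<tau>] by blast
  \<comment> \<open>Singletons form a network, so the netweight of a countable group is countable;
    equality with the weight makes \<open>\<B>\<close> a countable basis.\<close>
  have "network_of \<tau> (range (\<lambda>x. {x}))"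
    using \<tau>(1) by (auto simp: network_of_def group_topology_def)
  then have "|\<B>| \<le>o |range (\<lambda>x::'a. {x})|"
    using N(3) B(2) eq N(2) ordIso_ordLeq_trans by fastforce
  then have "countable \<B>"
    using count by (meson card_of_ordLeq countable_image countable_image_inj_on countable_subset image_subset_iff)
  then have "second_countable \<tau>"
    using B(1) unfolding second_countable_def basis_of_def by (intro exI[of _ \<B>]) simp
  then show "metrizable_space \<tau>"
    using second_countable_regular_imp_metrizable_space group_topology_imp_regular_space \<tau> by blast
qed

end
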